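(* Let $R$ be a ring, $(S,\preceq)$ a strictly totally ordered monoid, and $\omega: S\to \mathrm{End}(R)$ a monoid homomorphism, and assume that $R$ is $S$-compatible. If $R$ is abelian and semi-regular and its Jacobson radical $J(R)$ is nilpotent, then $R$ is $(S,\omega)$-McCoy.
   Context: All rings are associative with identity (not necessarily commutative), and all monoids have an identity; both identities are denoted $1$. A monoid $S$ (written multiplicatively) with a total order $\preceq$ is a strictly totally ordered monoid if $s_1\prec s_2$ implies $s_1t\prec s_2t$ and $ts_1\prec ts_2$ for all $s_1,s_2,t\in S$. For $s\in S$ write $\omega_s=\omega(s)$. The skew generalized power series ring $R[[S,\omega,\preceq]]$ is the set of all functions $f:S\to R$ whose support $\mathrm{Supp}(f)=\{s\in S: f(s)\neq 0\}$ is artinian (every strictly decreasing sequence of elements is finite) and narrow (every subset of pairwise incomparable elements is finite; automatic for a total order), with pointwise addition and multiplication $(fg)(s)=\sum_{(u,v)\in X_s(f,g)} f(u)\,\omega_u(g(v))$, where $X_s(f,g)=\{(u,v)\in \mathrm{Supp}(f)\times\mathrm{Supp}(g): uv=s\}$, which is a finite set. $R$ embeds in it by sending $r$ to the function $c_r$ with $c_r(1)=r$ and $c_r(x)=0$ for $x\ne 1$. $R$ is right $(S,\omega)$-McCoy if whenever $fg=0$ for non-zero $f,g\in R[[S,\omega,\preceq]]$, there exists a non-zero $c\in R$ with $fc=0$, equivalently $f(s)\,\omega_s(c)=0$ for all $s\in S$. It is left $(S,\omega)$-McCoy if whenever $fg=0$ for non-zero $f,g\in R[[S,\omega,\preceq]]$,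 there exists a non-zero $c\in R$ with $cg=0$, equivalently $c\,g(s)=0$ for all $s\in S$. It is $(S,\omega)$-McCoy if it is both left and right $(S,\omega)$-McCoy. $R$ is $S$-compatible (with respect to $\omega$) if for all $a,b\in R$ and all $s\in S$: $ab=0$ if and only if $a\,\omega_s(b)=0$. $R$ is abelian if every idempotent of $R$ is central. $R$ is semi-regular if $R/J(R)$ is von Neumann regular and idempotents lift modulo $J(R)$. *)

theory Defs
  imports "HOL-Algebra.Ideal_Product" "HOL-Algebra.QuotRing"
begin

section \<open>Strictly totally ordered monoids\<close>

locale strictly_totally_ordered_monoid = monoid S
  for S :: "('s, 'm) monoid_scheme" (structure) and leS :: "'s rel" +
  assumes linear_order: "linear_order_on (carrier S) leS"
    and strict_mult_right:
      "\<lbrakk> s1 \<in> carrier S; s2 \<in> carrier S; t \<in> carrier S; (s1, s2) \<in> leS; s1 \<noteq> s2 \<rbrakk>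
        \<Longrightarrow> (s1 \<otimes> t, s2 \<otimes> t) \<in> leS \<and> s1 \<otimes> t \<noteq> s2 \<otimes> t"
    and strict_mult_left:
      "\<lbrakk> s1 \<in> carrier S; s2 \<in> carrier S; t \<in> carrier S; (s1, s2) \<in> leS; s1 \<noteq> s2 \<rbrakk>
        \<Longrightarrow> (t \<otimes> s1, t \<otimes> s2) \<in> leS \<and> t \<otimes> s1 \<noteq> t \<otimes> s2"

definition artinian_set :: "'s rel \<Rightarrow> 's set \<Rightarrow> bool"
  where "artinian_set leS A \<longleftrightarrow>
    \<not> (\<exists>x :: nat \<Rightarrow> 's. \<forall>n. x n \<in> A \<and> (x (Suc n), x n) \<in> leS \<and> x (Suc n) \<noteq> x n)"

definition narrow_set :: "'s rel \<Rightarrow> 's set \<Rightarrow> bool"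
  where "narrow_set leS A \<longleftrightarrow>
    (\<forall>B \<subseteq> A. (\<forall>x \<in> B. \<forall>y \<in> B. x \<noteq> y \<longrightarrow> (x, y) \<notin> leS \<and> (y, x) \<notin> leS) \<longrightarrow> finite B)"

section \<open>Ring-theoretic notions\<close>

text \<open>Endomorphisms are taken to be extensional, so that equality in the monoid End(R) is
  equality of functions on the carrier.  \<^const>\<open>ring_hom\<close> includes preservation of the identity.\<close>

definition ring_End :: "('a, 'n) ring_scheme \<Rightarrow> ('a \<Rightarrow> 'a) monoid"
  where "ring_End R =
    \<lparr> carrier = ring_hom R R \<inter> extensional (carrier R),
      monoid.mult = compose (carrier R),
      one = (\<lambda>x \<in> carrier R. x) \<rparr>"

text \<open>\<^const>\<open>hom\<close> by itself does not require preservation of the identity.\<close>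

definition monoid_hom :: "('a, 'm) monoid_scheme \<Rightarrow> ('b, 'n) monoid_scheme \<Rightarrow> ('a \<Rightarrow> 'b) set"
  where "monoid_hom M N = {h \<in> hom M N. h \<one>\<^bsub>M\<^esub> = \<one>\<^bsub>N\<^esub>}"

definition left_ideal :: "'a set \<Rightarrow> ('a, 'n) ring_scheme \<Rightarrow> bool"
  where "left_ideal I R \<longleftrightarrow>
    additive_subgroup I R \<and> (\<forall>r \<in> carrier R. \<forall>x \<in> I. r \<otimes>\<^bsub>R\<^esub> x \<in> I)"

definition maximal_left_ideal :: "'a set \<Rightarrow> ('a, 'n) ring_scheme \<Rightarrow> bool"
  where "maximal_left_ideal M R \<longleftrightarrow>
    left_ideal M R \<and> M \<noteq> carrier R \<and>
    (\<forall>K. left_ideal K R \<and> M \<subseteq> K \<longrightarrow> K = M \<or> K = carrier R)"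

definition jacobson_radical :: "('a, 'n) ring_scheme \<Rightarrow> 'a set"
  where "jacobson_radical R = {x \<in> carrier R. \<forall>M. maximal_left_ideal M R \<longrightarrow> x \<in> M}"

text \<open>The multiplication of \<^const>\<open>ideals_set\<close> is the product of ideals, so the power below is
  the usual power of an ideal.\<close>

definition nilpotent_ideal :: "'a set \<Rightarrow> ('a, 'n) ring_scheme \<Rightarrow> bool"
  where "nilpotent_ideal I R \<longleftrightarrow> (\<exists>n::nat. n \<ge> 1 \<and> I [^]\<^bsub>ideals_set R\<^esub> n = {\<zero>\<^bsub>R\<^esub>})"

definition idempotents :: "('a, 'n) ring_scheme \<Rightarrow> 'a set"
  where "idempotents R = {e \<in> carrier R. e \<otimes>\<^bsub>R\<^esub> e = e}"

definition abelian_idempotents :: "('a, 'n) ring_scheme \<Rightarrow> bool"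
  where "abelian_idempotents R \<longleftrightarrow>
    (\<forall>e \<in> idempotents R. \<forall>x \<in> carrier R. e \<otimes>\<^bsub>R\<^esub> x = x \<otimes>\<^bsub>R\<^esub> e)"

definition von_neumann_regular :: "('a, 'n) ring_scheme \<Rightarrow> bool"
  where "von_neumann_regular R \<longleftrightarrow>
    (\<forall>a \<in> carrier R. \<exists>x \<in> carrier R. a = a \<otimes>\<^bsub>R\<^esub> x \<otimes>\<^bsub>R\<^esub> a)"

definition idempotents_lift :: "('a, 'n) ring_scheme \<Rightarrow> 'a set \<Rightarrow> bool"
  where "idempotents_lift R I \<longleftrightarrow>
    (\<forall>u \<in> idempotents (R Quot I). \<exists>e \<in> idempotents R. I +>\<^bsub>R\<^esub> e = u)"

definition semi_regular :: "('a, 'n) ring_scheme \<Rightarrow> bool"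
  where "semi_regular R \<longleftrightarrow>
    von_neumann_regular (R Quot jacobson_radical R) \<and> idempotents_lift R (jacobson_radical R)"

definition S_compatible ::
    "('r, 'n) ring_scheme \<Rightarrow> ('s, 'm) monoid_scheme \<Rightarrow> ('s \<Rightarrow> 'r \<Rightarrow> 'r) \<Rightarrow> bool"
  where "S_compatible R S \<omega> \<longleftrightarrow>
    (\<forall>a \<in> carrier R. \<forall>b \<in> carrier R. \<forall>s \<in> carrier S.
      a \<otimes>\<^bsub>R\<^esub> b = \<zero>\<^bsub>R\<^esub> \<longleftrightarrow> a \<otimes>\<^bsub>R\<^esub> \<omega> s b = \<zero>\<^bsub>R\<^esub>)"

section \<open>Skew generalized power series\<close>

definition Supp ::
    "('r, 'n) ring_scheme \<Rightarrow> ('s, 'm) monoid_scheme \<Rightarrow> ('s \<Rightarrow> 'r) \<Rightarrow> 's set"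
  where "Supp R S f = {s \<in> carrier S. f s \<noteq> \<zero>\<^bsub>R\<^esub>}"

definition X_set ::
    "('r, 'n) ring_scheme \<Rightarrow> ('s, 'm) monoid_scheme \<Rightarrow> 's \<Rightarrow> ('s \<Rightarrow> 'r) \<Rightarrow> ('s \<Rightarrow> 'r) \<Rightarrow> ('s \<times> 's) set"
  where "X_set R S s f g = {(u, v) \<in> Supp R S f \<times> Supp R S g. u \<otimes>\<^bsub>S\<^esub> v = s}"

definition const_series ::
    "('r, 'n) ring_scheme \<Rightarrow> ('s, 'm) monoid_scheme \<Rightarrow> 'r \<Rightarrow> 's \<Rightarrow> 'r"
  where "const_series R S r = (\<lambda>x \<in> carrier S. if x = \<one>\<^bsub>S\<^esub> then r else \<zero>\<^bsub>R\<^esub>)"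

text \<open>The ring of skew generalized power series.  Series are extensional functions on the carrier
  of the monoid.  The sum defining the product ranges over a finite set whenever both factors
  belong to the carrier and the monoid is strictly ordered; \<^const>\<open>finsum\<close> is only
  meaningful in that case.\<close>

definition sgps_ring ::
    "('r, 'n) ring_scheme \<Rightarrow> ('s, 'm) monoid_scheme \<Rightarrow> ('s \<Rightarrow> 'r \<Rightarrow> 'r) \<Rightarrow> 's rel \<Rightarrow> ('s \<Rightarrow> 'r) ring"
  where "sgps_ring R S \<omega> leS =
    \<lparr> carrier = {f \<in> carrier S \<rightarrow>\<^sub>E carrier R.
        artinian_set leS (Supp R S f) \<and> narrow_set leS (Supp R S f)},
      monoid.mult = (\<lambda>f g. \<lambda>s \<in> carrier S.
        finsum R (\<lambda>(u, v). f u \<otimes>\<^bsub>R\<^esub> \<omega> u (g v)) (X_set R S s f g)),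
      one = const_series R S \<one>\<^bsub>R\<^esub>,
      zero = (\<lambda>s \<in> carrier S. \<zero>\<^bsub>R\<^esub>),
      add = (\<lambda>f g. \<lambda>s \<in> carrier S. f s \<oplus>\<^bsub>R\<^esub> g s) \<rparr>"

definition right_McCoy ::
    "('r, 'n) ring_scheme \<Rightarrow> ('s, 'm) monoid_scheme \<Rightarrow> ('s \<Rightarrow> 'r \<Rightarrow> 'r) \<Rightarrow> 's rel \<Rightarrow> bool"
  where "right_McCoy R S \<omega> leS \<longleftrightarrow>
    (let A = sgps_ring R S \<omega> leS in
      \<forall>f \<in> carrier A. \<forall>g \<in> carrier A.
        f \<noteq> \<zero>\<^bsub>A\<^esub> \<longrightarrow> g \<noteq> \<zero>\<^bsub>A\<^esub> \<longrightarrow> f \<otimes>\<^bsub>A\<^esub> g = \<zero>\<^bsub>A\<^esub> \<longrightarrow>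
        (\<exists>c \<in> carrier R. c \<noteq> \<zero>\<^bsub>R\<^esub> \<and> f \<otimes>\<^bsub>A\<^esub> const_series R S c = \<zero>\<^bsub>A\<^esub>))"

definition left_McCoy ::
    "('r, 'n) ring_scheme \<Rightarrow> ('s, 'm) monoid_scheme \<Rightarrow> ('s \<Rightarrow> 'r \<Rightarrow> 'r) \<Rightarrow> 's rel \<Rightarrow> bool"
  where "left_McCoy R S \<omega> leS \<longleftrightarrow>
    (let A = sgps_ring R S \<omega> leS in
      \<forall>f \<in> carrier A. \<forall>g \<in> carrier A.
        f \<noteq> \<zero>\<^bsub>A\<^esub> \<longrightarrow> g \<noteq> \<zero>\<^bsub>A\<^esub> \<longrightarrow> f \<otimes>\<^bsub>A\<^esub> g = \<zero>\<^bsub>A\<^esub> \<longrightarrow>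
        (\<exists>c \<in> carrier R. c \<noteq> \<zero>\<^bsub>R\<^esub> \<and> const_series R S c \<otimes>\<^bsub>A\<^esub> g = \<zero>\<^bsub>A\<^esub>))"

definition McCoy ::
    "('r, 'n) ring_scheme \<Rightarrow> ('s, 'm) monoid_scheme \<Rightarrow> ('s \<Rightarrow> 'r \<Rightarrow> 'r) \<Rightarrow> 's rel \<Rightarrow> bool"
  where "McCoy R S \<omega> leS \<longleftrightarrow> left_McCoy R S \<omega> leS \<and> right_McCoy R S \<omega> leS"

end

theory Submission
  imports Defs
begin

text \<open>Write \<open>J\<close> for the Jacobson radical, with \<open>J\<^sup>n = 0\<close>.  The quotient by \<open>J\<close> is von Neumann
  regular and its idempotents lift to central ones, so it is strongly regular: modulo \<open>J\<close> every
  element \<open>a\<close> is a unit times an idempotent.  Because \<open>J\<close> is nilpotent this description lifts to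
  the ring itself (\<open>unit_part_exists\<close>): there is a central idempotent \<open>e\<close> such that \<open>a e\<close> is a
  unit of the corner \<open>e R\<close>, while \<open>a - a e\<close> lies in \<open>J\<close>.

  Suppose now that \<open>f g = 0\<close> for two series and let \<open>e\<^sub>s\<close> be such an idempotent for \<open>f s\<close>.  The
  heart of the proof is that \<open>e\<^sub>s\<close> annihilates every coefficient of \<open>g\<close>
  (\<open>unit_part_annihilates\<close>).  This goes by induction along the well-ordered support of \<open>f\<close>.  For
  \<open>u < s\<close> the induction hypothesis allows \<open>f u\<close> to be replaced by its part in \<open>J\<close>.  The
  coefficients of \<open>g\<close> are measured by the filtration of the ring by the annihilators of the
  powers of \<open>J\<close>, along which multiplication by \<open>J\<close> moves down by one step.  If \<open>k + 1\<close> is least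
  such that \<open>J\<^sup>k\<^sup>+\<^sup>1\<close> annihilates all \<open>e\<^sub>s g\<close>, and \<open>t\<close> is least such that \<open>J\<^sup>k\<close> does not annihilate
  \<open>e\<^sub>s (g t)\<close>, then, after multiplication by \<open>J\<^sup>k e\<^sub>s\<close>, only the term of \<open>(s, t)\<close> survives in the
  coefficient of \<open>f g\<close> at the product of \<open>s\<close> and \<open>t\<close>.  As \<open>f s\<close> is a unit on \<open>e\<^sub>s R\<close>, this
  contradicts \<open>f g = 0\<close>.

  Consequently each \<open>f s\<close> acts on the coefficients of \<open>g\<close> through an element of \<open>J\<close>.  Choosing
  \<open>k\<close> and \<open>j\<close> in \<open>J\<^sup>k\<close> with \<open>c = j (g t) \<noteq> 0\<close> but \<open>J\<^sup>k\<^sup>+\<^sup>1\<close> annihilating all coefficients of \<open>g\<close>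
  yields \<open>(f s) c = 0\<close> for every \<open>s\<close> (\<open>exists_common_annihilator\<close>).

  The endomorphisms disappear from the argument altogether: compatibility shows that a product
  \<open>a (f u) \<omega>\<^sub>u(g v) b\<close> vanishes exactly when \<open>a (f u) (g v) b\<close> does (\<open>untwist\<close>).  What remains is
  a statement about two well-ordered families of ring elements which is symmetric under passing to
  the opposite ring and exchanging the families, so the left-hand assertion is the right-hand one
  for the opposite ring.\<close>

section \<open>The Jacobson radical\<close>

context ring
begin

text \<open>Right multiplication by \<open>r\<close> identifies the quotient of the ring by this residual with the
  submodule generated by \<open>r\<close> in the simple module \<open>R / M\<close>, which is everything since \<open>r \<notin> M\<close>.\<close>

lemma maximal_left_ideal_residual:
  assumes "maximal_left_ideal M R" "r \<in> carrier R" "r \<notin> M"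
  shows "maximal_left_ideal {y \<in> carrier R. y \<otimes> r \<in> M} R" (is "maximal_left_ideal ?K R")
proof -
  have M: "additive_subgroup M R" and Ml: "\<And>a x. a \<in> carrier R \<Longrightarrow> x \<in> M \<Longrightarrow> a \<otimes> x \<in> M"
    and Mmax: "\<And>K. left_ideal K R \<Longrightarrow> M \<subseteq> K \<Longrightarrow> K = M \<or> K = carrier R"
    using assms(1) unfolding maximal_left_ideal_def left_ideal_def by auto
  interpret M: additive_subgroup M R by (rule M)
  have neg: "\<ominus> x \<in> M" if "x \<in> M" for x
    using Ml[of "\<ominus> \<one>" x] that M.a_Hcarr[OF that] by (simp add: l_minus)
  have K: "left_ideal ?K R"
    unfolding left_ideal_def
  proof (intro conjI ballI additive_subgroup.intro add.subgroupI)
    show "?K \<noteq> {}" using assms(2) by (auto intro!: exI[of _ \<zero>])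
  next
    fix x assume "x \<in> ?K" then show "\<ominus> x \<in> ?K"
      using assms(2) neg by (simp add: l_minus)
  next
    fix x y assume "x \<in> ?K" "y \<in> ?K" then show "x \<oplus> y \<in> ?K"
      using assms(2) by (simp add: l_distr)
  next
    fix x y assume "x \<in> carrier R" "y \<in> ?K" then show "x \<otimes> y \<in> ?K"
      using assms(2) Ml by (simp add: m_assoc)
  qed auto
  have "\<one> \<notin> ?K" using assms by simp
  then have ne: "?K \<noteq> carrier R" by blast
  have "L = carrier R" if L: "left_ideal L R" "?K \<subseteq> L" "L \<noteq> ?K" for L
  proof -
    interpret L: additive_subgroup L R using L(1) by (simp add: left_ideal_def)
    have Ll: "\<And>a x. a \<in> carrier R \<Longrightarrow> x \<in> L \<Longrightarrow> a \<otimes> x \<in> L"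
      using L(1) by (simp add: left_ideal_def)
    obtain l where l: "l \<in> L" "l \<notin> ?K" using L by blast
    have lc: "l \<in> carrier R" and lr: "l \<otimes> r \<notin> M" using l L.a_Hcarr by auto
    \<comment> \<open>The left ideal \<open>R l r + M\<close> is larger than \<open>M\<close>, hence contains \<open>r\<close>, and this makes
      \<open>1 - s l\<close> an element of the residual for some \<open>s\<close>.\<close>
    let ?Q = "{s \<otimes> (l \<otimes> r) \<oplus> m | s m. s \<in> carrier R \<and> m \<in> M}"
    have QI: "s \<otimes> (l \<otimes> r) \<oplus> m \<in> ?Q" if "s \<in> carrier R" "m \<in> M" for s m
      using that by blast
    have "left_ideal ?Q R"
      unfolding left_ideal_def
    proof (intro conjI ballI additive_subgroup.intro add.subgroupI)
      show "?Q \<subseteq> carrier R" using lc assms(2) by auto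
      show "?Q \<noteq> {}" using M.zero_closed by blast
    next
      fix x assume "x \<in> ?Q"
      then obtain s m where x: "x = s \<otimes> (l \<otimes> r) \<oplus> m" "s \<in> carrier R" "m \<in> M" by blast
      have "\<ominus> x = (\<ominus> s) \<otimes> (l \<otimes> r) \<oplus> (\<ominus> m)"
        using x lc assms(2) M.a_Hcarr[OF x(3)] by (simp add: minus_add l_minus)
      then show "\<ominus> x \<in> ?Q" using QI[of "\<ominus> s" "\<ominus> m"] x neg by simp
    next
      fix x y assume "x \<in> ?Q" "y \<in> ?Q"
      then obtain s m s' m' where x: "x = s \<otimes> (l \<otimes> r) \<oplus> m" "s \<in> carrier R" "m \<in> M"
        and y: "y = s' \<otimes> (l \<otimes> r) \<oplus> m'" "s' \<in> carrier R" "m' \<in> M" by blast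
      have "x \<oplus> y = (s \<oplus> s') \<otimes> (l \<otimes> r) \<oplus> (m \<oplus> m')"
        using x y lc assms(2) M.a_Hcarr[OF x(3)] M.a_Hcarr[OF y(3)]
        by (simp add: l_distr a_ac)
      then show "x \<oplus> y \<in> ?Q" using QI[of "s \<oplus> s'" "m \<oplus> m'"] x y by simp
    next
      fix z x assume z: "z \<in> carrier R" and "x \<in> ?Q"
      then obtain s m where x: "x = s \<otimes> (l \<otimes> r) \<oplus> m" "s \<in> carrier R" "m \<in> M" by blast
      have "z \<otimes> x = (z \<otimes> s) \<otimes> (l \<otimes> r) \<oplus> z \<otimes> m"
        using x z lc assms(2) M.a_Hcarr[OF x(3)] by (simp add: r_distr m_assoc)
      then show "z \<otimes> x \<in> ?Q" using QI[of "z \<otimes> s" "z \<otimes> m"] x z Ml by simp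
    qed
    moreover have "M \<subseteq> ?Q"
    proof
      fix m assume "m \<in> M"
      then show "m \<in> ?Q" using QI[of \<zero> m] lc assms(2) M.a_Hcarr by simp
    qed
    moreover have "l \<otimes> r \<in> ?Q"
      using QI[of \<one> \<zero>] lc assms(2) by simp
    ultimately have "r \<in> ?Q" using Mmax[of ?Q] lr assms(2) by blast
    then obtain s m where s: "r = s \<otimes> (l \<otimes> r) \<oplus> m" "s \<in> carrier R" "m \<in> M" by blast
    have "(\<one> \<ominus> s \<otimes> l) \<otimes> r = r \<ominus> s \<otimes> (l \<otimes> r)"
      using s(2) lc assms(2) by (simp add: a_minus_def l_distr l_minus m_assoc)
    also have "\<dots> = m"
      using s(2,3) lc assms(2) M.a_Hcarr[OF s(3)]
      by (subst s(1)) (simp add: a_minus_def a_ac r_neg1 r_neg2 r_neg l_neg)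
    finally have "\<one> \<ominus> s \<otimes> l \<in> ?K" using s lc by simp
    then have "(\<one> \<ominus> s \<otimes> l) \<oplus> s \<otimes> l \<in> L" using L(2) Ll[OF s(2) l(1)] by blast
    moreover have "(\<one> \<ominus> s \<otimes> l) \<oplus> s \<otimes> l = \<one>"
      using s(2) lc by (simp add: a_minus_def a_assoc l_neg)
    ultimately have "\<one> \<in> L" by simp
    then show ?thesis using Ll L.a_subset by fastforce
  qed
  with K ne show ?thesis unfolding maximal_left_ideal_def by blast
qed

text \<open>Closure under right multiplication is the point, since the radical is defined by left ideals: if
  \<open>r \<notin> M\<close>, an element \<open>x\<close> of the radical also lies in the maximal left ideal of those \<open>y\<close> with
  \<open>y r \<in> M\<close>.\<close>

lemma jacobson_radical_ideal: "ideal (jacobson_radical R) R" (is "ideal ?J R")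
proof (rule idealI)
  have M: "additive_subgroup M R" "a \<in> carrier R \<Longrightarrow> x \<in> M \<Longrightarrow> a \<otimes> x \<in> M"
    if "maximal_left_ideal M R" for M a x
    using that unfolding maximal_left_ideal_def left_ideal_def by auto
  show L: "a \<otimes> x \<in> ?J" if "x \<in> ?J" "a \<in> carrier R" for a x
    using that M unfolding jacobson_radical_def by auto
  show "subgroup ?J (add_monoid R)"
  proof (rule add.subgroupI)
    show "?J \<subseteq> carrier R" by (auto simp: jacobson_radical_def)
    have "\<zero> \<in> ?J"
      using additive_subgroup.zero_closed[OF M(1)] by (simp add: jacobson_radical_def)
    then show "?J \<noteq> {}" by blast
    show "\<ominus> x \<in> ?J" if "x \<in> ?J" for x
    proof -
      have "x \<in> carrier R" using that by (simp add: jacobson_radical_def)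
      then show ?thesis using L[OF that, of "\<ominus> \<one>"] by (simp add: l_minus)
    qed
    show "x \<oplus> y \<in> ?J" if "x \<in> ?J" "y \<in> ?J" for x y
      using that additive_subgroup.a_closed[OF M(1)] by (simp add: jacobson_radical_def)
  qed
  show "x \<otimes> r \<in> ?J" if x: "x \<in> ?J" and r: "r \<in> carrier R" for x r
  proof -
    have xc: "x \<in> carrier R" using x by (simp add: jacobson_radical_def)
    have "x \<otimes> r \<in> M" if max: "maximal_left_ideal M R" for M
    proof (cases "r \<in> M")
      case True then show ?thesis using M(2)[OF max xc] by simp
    next
      case False
      then show ?thesis using maximal_left_ideal_residual[OF max r] x
        by (auto simp: jacobson_radical_def)
    qed
    then show ?thesis using xc r by (simp add: jacobson_radical_def)
  qed
qed (rule ring_axioms)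

section \<open>Powers of an ideal\<close>

lemma ideal_pow_Suc:
  "I [^]\<^bsub>ideals_set R\<^esub> Suc k = ideal_prod R (I [^]\<^bsub>ideals_set R\<^esub> k) I"
  by (simp add: ideals_set_def)

lemma ideal_pow_ideal:
  assumes "ideal I R"
  shows "ideal (I [^]\<^bsub>ideals_set R\<^esub> (k::nat)) R"
proof (induction k)
  case 0
  then show ?case by (simp add: ideals_set_def oneideal)
next
  case (Suc k)
  then show ?case unfolding ideal_pow_Suc using assms by (rule ideal_prod_is_ideal)
qed

text \<open>The recursion of the power multiplies by \<open>I\<close> on the right; the mirrored rule needs an induction.\<close>

lemma ideal_pow_mult_left:
  assumes I: "ideal I R" and d: "d \<in> I" and "a \<in> I [^]\<^bsub>ideals_set R\<^esub> (k::nat)"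
  shows "d \<otimes> a \<in> I [^]\<^bsub>ideals_set R\<^esub> Suc k"
  using assms(3)
proof (induction k arbitrary: a)
  case 0
  then have a: "a \<in> carrier R" by (simp add: ideals_set_def)
  interpret I: ideal I R by (rule I)
  have "\<one> \<otimes> (d \<otimes> a) \<in> ideal_prod R (carrier R) I"
    using a d by (intro ideal_prod.prod) (auto intro: I.I_r_closed)
  then show ?case using a d I.Icarr by (simp add: ideals_set_def)
next
  case (Suc k)
  interpret I: ideal I R by (rule I)
  interpret P: ideal "I [^]\<^bsub>ideals_set R\<^esub> k" R by (rule ideal_pow_ideal[OF I])
  have sub: "ideal_prod R (I [^]\<^bsub>ideals_set R\<^esub> k) I \<subseteq> carrier R"
    by (rule ideal_prod_in_carrier[OF P.is_ideal I])
  have dc: "d \<in> carrier R" using d I.Icarr by simp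
  from Suc.prems have "a \<in> ideal_prod R (I [^]\<^bsub>ideals_set R\<^esub> k) I"
    unfolding ideal_pow_Suc .
  then show ?case
  proof (induction a rule: ideal_prod.induct)
    case (prod i j)
    have "(d \<otimes> i) \<otimes> j \<in> I [^]\<^bsub>ideals_set R\<^esub> Suc (Suc k)"
      unfolding ideal_pow_Suc[of I "Suc k"] using Suc.IH[OF prod(1)] prod(2)
      by (rule ideal_prod.prod)
    then show ?case using dc prod P.Icarr I.Icarr by (simp add: m_assoc)
  next
    case (sum a b)
    have "d \<otimes> (a \<oplus> b) = d \<otimes> a \<oplus> d \<otimes> b"
      using sum(1,2) sub dc by (simp add: r_distr subset_iff)
    then show ?case using sum(3,4) unfolding ideal_pow_Suc[of I "Suc k"]
      by (simp add: ideal_prod.sum)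
  qed
qed

section \<open>Splitting off the unit part of an element\<close>

text \<open>The geometric series of \<open>d\<close>, whose remainder after \<open>k\<close> terms lies in the \<open>k\<close>-th power of
  the ideal.\<close>

lemma one_minus_nilpotent_right_inverse:
  assumes I: "ideal I R" and nil: "I [^]\<^bsub>ideals_set R\<^esub> (n::nat) = {\<zero>}" and d: "d \<in> I"
  shows "\<exists>w\<in>carrier R. (\<one> \<ominus> d) \<otimes> w = \<one>"
proof -
  interpret I: ideal I R by (rule I)
  have dc: "d \<in> carrier R" using d I.Icarr by simp
  have "\<exists>w\<in>carrier R. \<exists>b\<in>I [^]\<^bsub>ideals_set R\<^esub> k. (\<one> \<ominus> d) \<otimes> w = \<one> \<ominus> b" for k :: nat
  proof (induction k)
    case 0
    show ?case
      using dc by (intro bexI[of _ \<zero>] bexI[of _ \<one>]) (auto simp: ideals_set_def a_minus_def r_neg)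
  next
    case (Suc k)
    then obtain w b where w: "w \<in> carrier R" and b: "b \<in> I [^]\<^bsub>ideals_set R\<^esub> k"
      and eq: "(\<one> \<ominus> d) \<otimes> w = \<one> \<ominus> b" by blast
    have bc: "b \<in> carrier R" using ideal.Icarr[OF ideal_pow_ideal[OF I]] b by blast
    have "(\<one> \<ominus> d) \<otimes> (w \<oplus> b) = (\<one> \<ominus> b) \<oplus> (\<one> \<ominus> d) \<otimes> b"
      using eq w bc dc by (simp add: r_distr)
    also have "\<dots> = \<one> \<ominus> d \<otimes> b"
      using bc dc by algebra
    finally show ?case using ideal_pow_mult_left[OF I d b] w bc by blast
  qed
  from this[of n] show ?thesis using nil by (auto simp: a_minus_def)
qed

end

text \<open>This lifts to the ring the factorization of \<open>a\<close> modulo \<open>J\<close> into a unit and an idempotent: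
  multiplication by \<open>a\<close> is invertible on the corner cut out by \<open>e\<close>, and what \<open>a\<close> does on the
  complementary corner is negligible.  The remainder is written as a summand from \<open>J\<close>, without
  subtraction, so that the notion involves only operations that are explicit in the opposite ring.\<close>

definition unit_part :: "('r, 'n) ring_scheme \<Rightarrow> 'r set \<Rightarrow> 'r \<Rightarrow> 'r \<Rightarrow> bool"
  where "unit_part R J a e \<longleftrightarrow>
    e \<in> carrier R \<and> (\<forall>x\<in>carrier R. e \<otimes>\<^bsub>R\<^esub> x = x \<otimes>\<^bsub>R\<^esub> e) \<and>
    (\<exists>x\<in>carrier R. x \<otimes>\<^bsub>R\<^esub> a \<otimes>\<^bsub>R\<^esub> e = e \<and> a \<otimes>\<^bsub>R\<^esub> x \<otimes>\<^bsub>R\<^esub> e = e) \<and>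
    (\<exists>d\<in>J. a = a \<otimes>\<^bsub>R\<^esub> e \<oplus>\<^bsub>R\<^esub> d)"

lemma unit_partE:
  assumes "unit_part R J a e"
  obtains x d where "e \<in> carrier R" "\<forall>y\<in>carrier R. e \<otimes>\<^bsub>R\<^esub> y = y \<otimes>\<^bsub>R\<^esub> e"
    "x \<in> carrier R" "x \<otimes>\<^bsub>R\<^esub> a \<otimes>\<^bsub>R\<^esub> e = e" "a \<otimes>\<^bsub>R\<^esub> x \<otimes>\<^bsub>R\<^esub> e = e"
    "d \<in> J" "a = a \<otimes>\<^bsub>R\<^esub> e \<oplus>\<^bsub>R\<^esub> d"
proof -
  from assms[unfolded unit_part_def] show thesis
    by (elim conjE bexE) (rule that)
qed

text \<open>A ring with central idempotents is Dedekind finite, as is every corner \<open>e R\<close>: if \<open>a x = 1\<close>, then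
  \<open>p = x a\<close> is idempotent, hence central, and \<open>1 = a (x a) x = p (a x) = p\<close>.\<close>

lemma (in ring) abelian_left_inverse_of_right_inverse:
  assumes ab: "abelian_idempotents R" and e: "e \<in> idempotents R"
    and a: "a \<in> carrier R" and x: "x \<in> carrier R" and right: "a \<otimes> x \<otimes> e = e"
  shows "x \<otimes> a \<otimes> e = e"
proof -
  have ec: "e \<in> carrier R" and ee: "e \<otimes> e = e" using e by (auto simp: idempotents_def)
  have comm: "e \<otimes> y = y \<otimes> e" if "y \<in> carrier R" for y
    using ab e that unfolding abelian_idempotents_def by blast
  define p where "p = x \<otimes> a \<otimes> e"
  have pc: "p \<in> carrier R" using ec a x by (simp add: p_def)
  have "p \<otimes> p = x \<otimes> (a \<otimes> (e \<otimes> x) \<otimes> (a \<otimes> e))"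
    using ec a x by (simp add: p_def m_assoc)
  also have "\<dots> = x \<otimes> ((a \<otimes> x \<otimes> e) \<otimes> (a \<otimes> e))"
    using ec a x by (simp add: comm[OF x] m_assoc)
  also have "\<dots> = x \<otimes> (e \<otimes> a \<otimes> e)" using ec a x right by (simp add: m_assoc)
  also have "\<dots> = p" using ec a x ee by (simp add: comm[OF a] p_def m_assoc)
  finally have "p \<in> idempotents R" using pc by (simp add: idempotents_def)
  then have pcomm: "p \<otimes> y = y \<otimes> p" if "y \<in> carrier R" for y
    using ab that unfolding abelian_idempotents_def by blast
  have "e = (a \<otimes> x \<otimes> e) \<otimes> (a \<otimes> x \<otimes> e)" using right ee by simp
  also have "\<dots> = a \<otimes> x \<otimes> (e \<otimes> a) \<otimes> x \<otimes> e" using ec a x by (simp add: m_assoc)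
  also have "\<dots> = a \<otimes> p \<otimes> (x \<otimes> e)" using ec a x comm[OF a] by (simp add: p_def m_assoc)
  also have "\<dots> = p \<otimes> (a \<otimes> x \<otimes> e)" 
    unfolding pcomm[OF a, symmetric] using pc ec a x by (simp add: m_assoc)
  also have "\<dots> = p" using right ec a x ee by (simp add: p_def m_assoc)
  finally show ?thesis by (simp add: p_def)
qed

text \<open>If \<open>a \<equiv> a y a\<close> modulo the ideal, then \<open>a y\<close> is idempotent there and lifts to a central idempotent
  \<open>e\<close>.  It satisfies \<open>(1 - e) a \<equiv> a - a y a \<equiv> 0\<close>, and \<open>a y\<close> acts on \<open>e R\<close> as \<open>1 - d\<close> with \<open>d\<close> in
  the nilpotent ideal, so \<open>a\<close> has a right inverse in the corner.\<close>

lemma (in ring) unit_part_exists: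
  assumes I: "ideal I R" and nil: "I [^]\<^bsub>ideals_set R\<^esub> (n::nat) = {\<zero>}"
    and ab: "abelian_idempotents R" and reg: "von_neumann_regular (R Quot I)"
    and lift: "idempotents_lift R I" and a: "a \<in> carrier R"
  shows "\<exists>e. unit_part R I a e"
proof -
  interpret I: ideal I R by (rule I)
  have cmult: "(I +> x) \<otimes>\<^bsub>R Quot I\<^esub> (I +> y) = I +> (x \<otimes> y)"
    if "x \<in> carrier R" "y \<in> carrier R" for x y
    using I.rcoset_mult_add[OF that] by (simp add: FactRing_def)
  have ccar: "carrier (R Quot I) = (\<lambda>x. I +> x) ` carrier R"
    by (auto simp: FactRing_simps)
  have ceq: "I +> x = I +> y \<longleftrightarrow> x \<ominus> y \<in> I" if "x \<in> carrier R" "y \<in> carrier R" for x y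
    using quotient_eq_iff_same_a_r_cos[OF I that] by simp
  obtain y where y: "y \<in> carrier R" and "I +> a = I +> (a \<otimes> y \<otimes> a)"
    using reg a unfolding von_neumann_regular_def ccar by (auto simp: cmult)
  then have r: "a \<ominus> a \<otimes> y \<otimes> a \<in> I" using a by (simp add: ceq)
  have "a \<otimes> y \<otimes> (a \<otimes> y) \<ominus> a \<otimes> y = \<ominus> ((a \<ominus> a \<otimes> y \<otimes> a) \<otimes> y)"
    using a y by algebra
  then have "a \<otimes> y \<otimes> (a \<otimes> y) \<ominus> a \<otimes> y \<in> I"
    using I.I_r_closed[OF r y] I.a_inv_closed by simp
  then have "I +> (a \<otimes> y) \<in> idempotents (R Quot I)"
    using a y by (auto simp: idempotents_def ccar cmult ceq)
  then obtain e where e: "e \<in> idempotents R" and "I +> e = I +> (a \<otimes> y)"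
    using lift unfolding idempotents_lift_def by blast
  moreover have ec: "e \<in> carrier R" and ee: "e \<otimes> e = e" using e by (auto simp: idempotents_def)
  ultimately have d: "e \<ominus> a \<otimes> y \<in> I" using a y by (simp add: ceq)
  have comm: "e \<otimes> x = x \<otimes> e" if "x \<in> carrier R" for x
    using ab e that unfolding abelian_idempotents_def by blast
  obtain w where w: "w \<in> carrier R" and inv: "(\<one> \<ominus> (e \<ominus> a \<otimes> y)) \<otimes> w = \<one>"
    using one_minus_nilpotent_right_inverse[OF I nil d] by blast
  have "e \<otimes> (\<one> \<ominus> (e \<ominus> a \<otimes> y)) = e \<ominus> e \<otimes> e \<oplus> e \<otimes> (a \<otimes> y)"
    using a y ec by (simp add: a_minus_def r_distr minus_add r_minus a_assoc)
  also have "\<dots> = a \<otimes> y \<otimes> e" using a y ec ee comm[of "a \<otimes> y"] by (simp add: a_minus_def r_neg)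
  finally have *: "a \<otimes> y \<otimes> e = e \<otimes> (\<one> \<ominus> (e \<ominus> a \<otimes> y))" by simp
  have "a \<otimes> (y \<otimes> w) \<otimes> e = (a \<otimes> y \<otimes> e) \<otimes> w"
    using a y w ec comm[OF w] by (simp add: m_assoc)
  also have "\<dots> = e \<otimes> ((\<one> \<ominus> (e \<ominus> a \<otimes> y)) \<otimes> w)"
    unfolding * using a y w ec by (simp add: m_assoc)
  finally have right: "a \<otimes> (y \<otimes> w) \<otimes> e = e" using inv ec by simp
  have left: "(y \<otimes> w) \<otimes> a \<otimes> e = e"
    using abelian_left_inverse_of_right_inverse[OF ab e a _ right] y w by simp
  have "a \<ominus> e \<otimes> a = (a \<ominus> a \<otimes> y \<otimes> a) \<ominus> (e \<ominus> a \<otimes> y) \<otimes> a"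
    using a y ec by algebra
  then have "a \<ominus> e \<otimes> a \<in> I"
    using r I.I_r_closed[OF d a] by (simp add: a_minus_def)
  moreover have "a = a \<otimes> e \<oplus> (a \<ominus> e \<otimes> a)"
    using a ec comm[OF a] by (simp add: a_minus_def a_lcomm r_neg)
  ultimately show ?thesis
    unfolding unit_part_def using ec comm right left y w by blast
qed

section \<open>Artinian subsets of a linear order\<close>

text \<open>Without a least element, stepping to a smaller one forever gives an infinite descending sequence.\<close>

lemma artinian_set_least:
  assumes lin: "linear_order_on C r" and "artinian_set r A" and "B \<subseteq> A" "B \<subseteq> C" "B \<noteq> {}"
  shows "\<exists>m\<in>B. \<forall>x\<in>B. (m, x) \<in> r"
proof (rule ccontr)
  assume no: "\<not> ?thesis"
  have "\<exists>y\<in>B. (y, x) \<in> r \<and> y \<noteq> x" if x: "x \<in> B" for x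
  proof -
    obtain y where y: "y \<in> B" "(x, y) \<notin> r" using no x by blast
    have "x \<in> C" "y \<in> C" using x y(1) assms(4) by auto
    moreover have "total_on C r" "refl_on C r"
      using lin by (auto simp: linear_order_on_def partial_order_on_def preorder_on_def)
    ultimately have "x = y \<or> (x, y) \<in> r \<or> (y, x) \<in> r" "(x, x) \<in> r"
      by (auto simp: total_on_def refl_on_def)
    then show ?thesis using y by auto
  qed
  then obtain h where h: "\<And>x. x \<in> B \<Longrightarrow> h x \<in> B \<and> (h x, x) \<in> r \<and> h x \<noteq> x"
    using bchoice[of B "\<lambda>x y. y \<in> B \<and> (y, x) \<in> r \<and> y \<noteq> x"] by blast
  obtain b where b: "b \<in> B" using assms(5) by blast
  have B: "(h ^^ k) b \<in> B" for k
  proof (induction k)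
    case (Suc k) then show ?case using h[OF Suc] by simp
  qed (simp add: b)
  have "\<exists>x :: nat \<Rightarrow> _. \<forall>k. x k \<in> A \<and> (x (Suc k), x k) \<in> r \<and> x (Suc k) \<noteq> x k"
  proof (intro exI allI)
    show "(h ^^ k) b \<in> A \<and> ((h ^^ Suc k) b, (h ^^ k) b) \<in> r \<and> (h ^^ Suc k) b \<noteq> (h ^^ k) b"
      for k
      using h[OF B[of k]] B[of k] assms(3) by auto
  qed
  then show False using assms(2) unfolding artinian_set_def by blast
qed

text \<open>A well-order whose converse is also a well-order is finite: the first element with infinitely many
  predecessors would have a last strict predecessor, which has only finitely many predecessors.\<close>

lemma finite_if_least_and_greatest:
  assumes lin: "linear_order_on C r" and "U \<subseteq> C"
    and least: "\<And>B. B \<subseteq> U \<Longrightarrow> B \<noteq> {} \<Longrightarrow> \<exists>m\<in>B. \<forall>x\<in>B. (m, x) \<in> r"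
    and greatest: "\<And>B. B \<subseteq> U \<Longrightarrow> B \<noteq> {} \<Longrightarrow> \<exists>m\<in>B. \<forall>x\<in>B. (x, m) \<in> r"
  shows "finite U"
proof -
  have antisym: "x = y" if "(x, y) \<in> r" "(y, x) \<in> r" for x y
    using lin that unfolding linear_order_on_def partial_order_on_def antisym_def by blast
  have total: "(x, y) \<in> r \<or> (y, x) \<in> r" if "x \<in> U" "y \<in> U" for x y
  proof (cases "x = y")
    case True
    then show ?thesis using lin that \<open>U \<subseteq> C\<close>
      unfolding linear_order_on_def partial_order_on_def preorder_on_def refl_on_def by blast
  next
    case False
    then show ?thesis using lin that \<open>U \<subseteq> C\<close> unfolding linear_order_on_def total_on_def by blast
  qed
  let ?below = "\<lambda>u. {x \<in> U. (x, u) \<in> r}"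
  have "{u \<in> U. infinite (?below u)} = {}"
  proof (rule ccontr)
    assume "{u \<in> U. infinite (?below u)} \<noteq> {}"
    then obtain u where u: "u \<in> U" "infinite (?below u)"
      and umin: "\<And>x. x \<in> U \<Longrightarrow> infinite (?below x) \<Longrightarrow> (u, x) \<in> r"
      using least[of "{u \<in> U. infinite (?below u)}"] by auto
    let ?strict = "{x \<in> U. (x, u) \<in> r \<and> x \<noteq> u}"
    have "finite ?strict"
    proof (cases "?strict = {}")
      case False
      then obtain m where m: "m \<in> ?strict" and mmax: "\<And>x. x \<in> ?strict \<Longrightarrow> (x, m) \<in> r"
        using greatest[of ?strict] by auto
      have "finite (?below m)" using umin[of m] m antisym by blast
      moreover have "?strict \<subseteq> ?below m" using mmax by blast
      ultimately show ?thesis by (rule finite_subset[rotated])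
    qed (simp only: finite.emptyI)
    moreover have "?below u \<subseteq> insert u ?strict" by blast
    ultimately show False using u(2) by (meson finite_insert finite_subset)
  qed
  then have below: "finite (?below u)" if "u \<in> U" for u using that by blast
  show ?thesis
  proof (cases "U = {}")
    case False
    then obtain m where "m \<in> U" "\<forall>x\<in>U. (x, m) \<in> r" using greatest[of U] by blast
    then have "U = ?below m" "finite (?below m)" using below by blast+
    then show ?thesis by simp
  qed simp
qed

section \<open>Products whose leading terms cannot cancel\<close>

text \<open>The situation left over from \<open>f g = 0\<close> once the monoid and its action are eliminated.  The
  hypothesis \<open>leading_product_zero\<close> replaces the vanishing of the convolution: a product of
  coefficients at \<open>(s, t)\<close> vanishes between multipliers \<open>a\<close> and \<open>b\<close> as soon as all those with
  \<open>u < s\<close> or \<open>v < t\<close> do, since every other decomposition of the product of \<open>s\<close> and \<open>t\<close> has one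
  of the factors smaller.  Two-sided multipliers keep the hypothesis invariant under passing to the
  opposite ring.  The sets \<open>P k\<close> are the powers of \<open>J\<close>; listing the closure properties of the
  powers elementwise lets the same sets serve for both rings.\<close>

locale well_ordered_zero_product = ring R for R (structure) +
  fixes C :: "'s set" and r :: "'s rel" and f g :: "'s \<Rightarrow> 'a"
    and J :: "'a set" and P :: "nat \<Rightarrow> 'a set" and n :: nat
  assumes linear: "linear_order_on C r"
    and f_closed: "s \<in> C \<Longrightarrow> f s \<in> carrier R"
    and g_closed: "t \<in> C \<Longrightarrow> g t \<in> carrier R"
    and f_artinian: "artinian_set r {s \<in> C. f s \<noteq> \<zero>}"
    and g_artinian: "artinian_set r {t \<in> C. g t \<noteq> \<zero>}"
    and leading_product_zero:
      "\<lbrakk> s \<in> C; t \<in> C; a \<in> carrier R; b \<in> carrier R;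
         \<And>u v. \<lbrakk> u \<in> C; v \<in> C; (u, s) \<in> r; u \<noteq> s \<rbrakk> \<Longrightarrow> a \<otimes> (f u \<otimes> g v) \<otimes> b = \<zero>;
         \<And>u v. \<lbrakk> u \<in> C; v \<in> C; (v, t) \<in> r; v \<noteq> t \<rbrakk> \<Longrightarrow> a \<otimes> (f u \<otimes> g v) \<otimes> b = \<zero> \<rbrakk>
       \<Longrightarrow> a \<otimes> (f s \<otimes> g t) \<otimes> b = \<zero>"
    and unit_part_f: "s \<in> C \<Longrightarrow> \<exists>e. unit_part R J (f s) e"
    and J_closed: "J \<subseteq> carrier R"
    and P_0: "P 0 = carrier R"
    and P_n: "P n = {\<zero>}"
    and P_closed: "P k \<subseteq> carrier R"
    and P_mult: "\<lbrakk> a \<in> P k; x \<in> carrier R \<rbrakk> \<Longrightarrow> a \<otimes> x \<in> P k"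
    and P_mult_J: "\<lbrakk> a \<in> P k; d \<in> J \<rbrakk> \<Longrightarrow> a \<otimes> d \<in> P (Suc k)"
    and J_mult_P: "\<lbrakk> d \<in> J; a \<in> P k \<rbrakk> \<Longrightarrow> d \<otimes> a \<in> P (Suc k)"
begin

text \<open>The least power of \<open>J\<close> that annihilates all \<open>x (g v)\<close> is not the zeroth one; \<open>k\<close> is its
  predecessor.\<close>

lemma annihilating_power:
  assumes "x \<in> carrier R" "t \<in> C" "x \<otimes> g t \<noteq> \<zero>"
  obtains k t' a where "t' \<in> C" "a \<in> P k" "a \<otimes> (x \<otimes> g t') \<noteq> \<zero>"
    and "\<forall>v\<in>C. \<forall>b\<in>P (Suc k). b \<otimes> (x \<otimes> g v) = \<zero>"
proof -
  define Z where "Z m \<longleftrightarrow> (\<forall>v\<in>C. \<forall>b\<in>P m. b \<otimes> (x \<otimes> g v) = \<zero>)" for m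
  have "Z n" using assms(1) g_closed by (simp add: Z_def P_n)
  moreover have "\<not> Z 0"
    using assms g_closed by (auto simp: Z_def P_0 intro!: bexI[of _ t] bexI[of _ \<one>])
  ultimately obtain k where "\<not> Z k" "Z (Suc k)"
    using ex_least_nat_less[of Z n] by (metis le_refl lessI)
  then show thesis using that unfolding Z_def by blast
qed

text \<open>Otherwise take \<open>s\<close> least with \<open>e (g t) \<noteq> 0\<close> for some \<open>t\<close>, then \<open>k\<close> as in
  \<open>annihilating_power\<close>, and finally \<open>t\<close> least with \<open>J\<^sup>k e (g t) \<noteq> 0\<close>, witnessed by \<open>a\<close>.  With the
  inverse \<open>x\<close> of \<open>f s\<close> in the corner, the multiplier \<open>a x e\<close> turns \<open>(f s) (g t)\<close> into
  \<open>a e (g t) \<noteq> 0\<close> but kills all products with smaller index in either factor.\<close>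

lemma unit_part_annihilates:
  assumes "s \<in> C" "unit_part R J (f s) e" "t \<in> C"
  shows "e \<otimes> g t = \<zero>"
proof -
  let ?B = "{s \<in> C. \<exists>e t. unit_part R J (f s) e \<and> t \<in> C \<and> e \<otimes> g t \<noteq> \<zero>}"
  have "?B = {}"
  proof (rule ccontr)
    assume ne: "?B \<noteq> {}"
    have "f s \<noteq> \<zero>" if up: "unit_part R J (f s) e" and t: "t \<in> C" "e \<otimes> g t \<noteq> \<zero>" for s e t
    proof
      assume "f s = \<zero>"
      obtain x where x: "e \<in> carrier R" "x \<in> carrier R" "x \<otimes> f s \<otimes> e = e"
        using up by (rule unit_partE)
      have "e = \<zero>" using x(3)[symmetric] x(1,2) \<open>f s = \<zero>\<close> by simp
      then show False using t g_closed by simp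
    qed
    then have "?B \<subseteq> {s \<in> C. f s \<noteq> \<zero>}" by blast
    then obtain s where "s \<in> ?B" and smin: "\<And>u. u \<in> ?B \<Longrightarrow> (s, u) \<in> r"
      using artinian_set_least[OF linear f_artinian _ _ ne] by auto
    then obtain e t where s: "s \<in> C" and up: "unit_part R J (f s) e"
      and t: "t \<in> C" "e \<otimes> g t \<noteq> \<zero>" by blast
    have antisym: "x = y" if "(x, y) \<in> r" "(y, x) \<in> r" for x y
      using linear that unfolding linear_order_on_def partial_order_on_def antisym_def by blast
    have IH: "e' \<otimes> g v = \<zero>"
      if "u \<in> C" "(u, s) \<in> r" "u \<noteq> s" "unit_part R J (f u) e'" "v \<in> C" for u v e'
      using smin[of u] antisym[of u s] that by blast
    from up obtain x where ec: "e \<in> carrier R" and ecomm: "\<forall>y\<in>carrier R. e \<otimes> y = y \<otimes> e"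
      and x: "x \<in> carrier R" "x \<otimes> f s \<otimes> e = e" by (rule unit_partE)
    obtain k t' a' where k: "t' \<in> C" "a' \<in> P k" "a' \<otimes> (e \<otimes> g t') \<noteq> \<zero>"
      and kSuc: "\<forall>v\<in>C. \<forall>b\<in>P (Suc k). b \<otimes> (e \<otimes> g v) = \<zero>"
      by (rule annihilating_power[OF ec t])
    let ?T = "{t \<in> C. \<exists>a\<in>P k. a \<otimes> (e \<otimes> g t) \<noteq> \<zero>}"
    have Pc: "\<And>a k. a \<in> P k \<Longrightarrow> a \<in> carrier R" using P_closed by blast
    have "?T \<subseteq> {t \<in> C. g t \<noteq> \<zero>}" using ec Pc by auto
    then obtain t where "t \<in> ?T" and tmin: "\<And>v. v \<in> ?T \<Longrightarrow> (t, v) \<in> r"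
      using artinian_set_least[OF linear g_artinian, of ?T] k by blast
    then obtain a where t: "t \<in> C" and a: "a \<in> P k" and nz: "a \<otimes> (e \<otimes> g t) \<noteq> \<zero>" by blast
    have tmin': "b \<otimes> (e \<otimes> g v) = \<zero>" if "v \<in> C" "(v, t) \<in> r" "v \<noteq> t" "b \<in> P k" for v b
      using tmin[of v] antisym[of v t] that by blast
    have ax: "a \<otimes> x \<in> P k" using P_mult[OF a x(1)] .
    have axc: "a \<otimes> x \<in> carrier R" using Pc[OF ax] .
    have "(a \<otimes> x \<otimes> e) \<otimes> (f s \<otimes> g t) \<otimes> \<one> = \<zero>"
    proof (rule leading_product_zero[OF s t])
      fix u v assume u: "u \<in> C" "(u, s) \<in> r" "u \<noteq> s" and v: "v \<in> C"
      \<comment> \<open>By minimality of \<open>s\<close> only the part \<open>d\<close> of \<open>f u\<close> in \<open>J\<close> acts on \<open>g v\<close>, and it raises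
        the exponent of the annihilating power to \<open>k + 1\<close>.\<close>
      obtain e' where up': "unit_part R J (f u) e'" using unit_part_f[OF u(1)] by blast
      then obtain d where e': "e' \<in> carrier R" and d: "d \<in> J" "f u = f u \<otimes> e' \<oplus> d"
        by (rule unit_partE)
      have dc: "d \<in> carrier R" using d J_closed by blast
      have "f u \<otimes> g v = (f u \<otimes> e' \<oplus> d) \<otimes> g v" using d(2) by simp
      also have "\<dots> = f u \<otimes> (e' \<otimes> g v) \<oplus> d \<otimes> g v"
        using f_closed[OF u(1)] e' dc g_closed[OF v] by (simp add: l_distr m_assoc)
      finally have "f u \<otimes> g v = d \<otimes> g v"
        using IH[OF u up' v] f_closed[OF u(1)] dc g_closed[OF v] by simp
      then have "(a \<otimes> x \<otimes> e) \<otimes> (f u \<otimes> g v) \<otimes> \<one> = (a \<otimes> x) \<otimes> ((e \<otimes> d) \<otimes> g v)"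
        using axc ec dc g_closed[OF v] Pc[OF a] x(1) by (simp add: m_assoc)
      also have "\<dots> = ((a \<otimes> x) \<otimes> d) \<otimes> (e \<otimes> g v)"
        unfolding ecomm[rule_format, OF dc] using axc ec dc g_closed[OF v] Pc[OF a] x(1) by (simp add: m_assoc)
      also have "\<dots> = \<zero>" by (rule kSuc[rule_format, OF v P_mult_J[OF ax d(1)]])
      finally show "(a \<otimes> x \<otimes> e) \<otimes> (f u \<otimes> g v) \<otimes> \<one> = \<zero>" .
    next
      \<comment> \<open>Here \<open>f u\<close> is absorbed by the ideal \<open>J\<^sup>k\<close>, and minimality of \<open>t\<close> applies.\<close>
      fix u v assume u: "u \<in> C" and v: "v \<in> C" "(v, t) \<in> r" "v \<noteq> t"
      have "(a \<otimes> x \<otimes> e) \<otimes> (f u \<otimes> g v) \<otimes> \<one> = (a \<otimes> x) \<otimes> ((e \<otimes> f u) \<otimes> g v)"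
        using ec f_closed[OF u] g_closed[OF v(1)] Pc[OF a] x(1) by (simp add: m_assoc)
      also have "\<dots> = ((a \<otimes> x) \<otimes> f u) \<otimes> (e \<otimes> g v)"
        unfolding ecomm[rule_format, OF f_closed[OF u]]
        using ec f_closed[OF u] g_closed[OF v(1)] Pc[OF a] x(1) by (simp add: m_assoc)
      also have "\<dots> = \<zero>" by (rule tmin'[OF v P_mult[OF ax f_closed[OF u]]])
      finally show "(a \<otimes> x \<otimes> e) \<otimes> (f u \<otimes> g v) \<otimes> \<one> = \<zero>" .
    qed (use axc ec in auto)
    moreover have "(a \<otimes> x \<otimes> e) \<otimes> (f s \<otimes> g t) \<otimes> \<one> = a \<otimes> (x \<otimes> (e \<otimes> f s) \<otimes> g t)"
      using ec f_closed[OF s] g_closed[OF t] Pc[OF a] x(1) by (simp add: m_assoc)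
    moreover have "x \<otimes> (e \<otimes> f s) = e"
      using x ecomm[rule_format, OF f_closed[OF s]] f_closed[OF s] ec by (simp add: m_assoc)
    ultimately show False using nz by simp
  qed
  then show ?thesis using assms by blast
qed

text \<open>The witness \<open>c = j (g t)\<close> comes from the last power \<open>J\<^sup>k\<close> not annihilating \<open>g\<close>: of
  \<open>f s = (f s) e + d\<close> the first summand kills \<open>c\<close> because \<open>e\<close> is central and \<open>e (g t) = 0\<close>, the
  second because \<open>d j \<in> J\<^sup>k\<^sup>+\<^sup>1\<close>.\<close>

lemma exists_common_annihilator:
  assumes "t \<in> C" "g t \<noteq> \<zero>"
  shows "\<exists>c\<in>carrier R. c \<noteq> \<zero> \<and> (\<forall>s\<in>C. f s \<otimes> c = \<zero>)"
proof -
  have Pc: "\<And>a k. a \<in> P k \<Longrightarrow> a \<in> carrier R" using P_closed by blast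
  have "\<one> \<otimes> g t \<noteq> \<zero>" using assms g_closed by simp
  then obtain k t j
    where t: "t \<in> C" and j: "j \<in> P k" and nz: "j \<otimes> (\<one> \<otimes> g t) \<noteq> \<zero>"
      and ann: "\<forall>v\<in>C. \<forall>b\<in>P (Suc k). b \<otimes> (\<one> \<otimes> g v) = \<zero>"
    by (rule annihilating_power[OF one_closed assms(1)])
  have gt: "g t \<in> carrier R" and jc: "j \<in> carrier R" using t g_closed j Pc by auto
  have "f s \<otimes> (j \<otimes> g t) = \<zero>" if s: "s \<in> C" for s
  proof -
    obtain e where up: "unit_part R J (f s) e" using unit_part_f[OF s] by blast
    then obtain d where ec: "e \<in> carrier R"
      and ecomm: "\<forall>y\<in>carrier R. e \<otimes> y = y \<otimes> e"
      and d: "d \<in> J" "f s = f s \<otimes> e \<oplus> d"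
      by (rule unit_partE)
    note e = ec ecomm[rule_format, OF jc]
    have dc: "d \<in> carrier R" using d J_closed by blast
    have fs: "f s \<in> carrier R" using f_closed[OF s] .
    have "(d \<otimes> j) \<otimes> g t = \<zero>"
      using ann[rule_format, OF t J_mult_P[OF d(1) j]] gt by simp
    moreover have "e \<otimes> (j \<otimes> g t) = j \<otimes> (e \<otimes> g t)"
      using m_assoc[OF e(1) jc gt, symmetric] m_assoc[OF jc e(1) gt] unfolding e(2) by (rule trans)
    ultimately have *: "d \<otimes> (j \<otimes> g t) = \<zero>" "e \<otimes> (j \<otimes> g t) = \<zero>"
      using unit_part_annihilates[OF s up t] dc jc gt by (simp_all add: m_assoc)
    have "f s \<otimes> (j \<otimes> g t) = (f s \<otimes> e \<oplus> d) \<otimes> (j \<otimes> g t)" using d(2) by simp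
    also have "\<dots> = f s \<otimes> (e \<otimes> (j \<otimes> g t)) \<oplus> d \<otimes> (j \<otimes> g t)"
      using fs e(1) dc jc gt by (simp add: l_distr m_assoc)
    finally show ?thesis using * fs by simp
  qed
  moreover have "j \<otimes> g t \<noteq> \<zero>" "j \<otimes> g t \<in> carrier R" using nz jc gt by simp_all
  ultimately show ?thesis by blast
qed

end

section \<open>The opposite ring\<close>

definition opposite :: "('r, 'n) ring_scheme \<Rightarrow> ('r, 'n) ring_scheme"
  where "opposite R = R\<lparr>monoid.mult := \<lambda>x y. y \<otimes>\<^bsub>R\<^esub> x\<rparr>"

lemma opposite_simps [simp]:
  "carrier (opposite R) = carrier R"
  "x \<otimes>\<^bsub>opposite R\<^esub> y = y \<otimes>\<^bsub>R\<^esub> x"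
  "\<one>\<^bsub>opposite R\<^esub> = \<one>\<^bsub>R\<^esub>"
  "\<zero>\<^bsub>opposite R\<^esub> = \<zero>\<^bsub>R\<^esub>"
  "x \<oplus>\<^bsub>opposite R\<^esub> y = x \<oplus>\<^bsub>R\<^esub> y"
  by (simp_all add: opposite_def)

lemma (in ring) ring_opposite: "ring (opposite R)"
proof (rule ringI)
  show "abelian_group (opposite R)"
    by (rule abelian_groupI) (auto simp: a_ac intro: bexI[of _ "\<ominus> _"] l_neg)
  show "monoid (opposite R)"
    by (rule monoidI) (auto simp: m_assoc)
qed (auto simp: l_distr r_distr)

lemma (in ring) unit_part_opposite:
  assumes up: "unit_part R J a e" and a: "a \<in> carrier R"
  shows "unit_part (opposite R) J a e"
proof -
  from up obtain x d where e: "e \<in> carrier R" and ecomm: "\<forall>y\<in>carrier R. e \<otimes> y = y \<otimes> e"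
    and x: "x \<in> carrier R" "x \<otimes> a \<otimes> e = e" "a \<otimes> x \<otimes> e = e"
    and d: "d \<in> J" "a = a \<otimes> e \<oplus> d"
    by (rule unit_partE)
  have "e \<otimes> (a \<otimes> x) = e" "e \<otimes> (x \<otimes> a) = e"
    using bspec[OF ecomm, of "a \<otimes> x"] bspec[OF ecomm, of "x \<otimes> a"] x a by simp_all
  moreover have "a = e \<otimes> a \<oplus> d" using d(2) ecomm[rule_format, OF a] by simp
  ultimately show ?thesis unfolding unit_part_def opposite_simps
    using e x(1) d(1) ecomm[rule_format, symmetric]
    by (intro conjI ballI bexI[of _ x] bexI[of _ d]) assumption+
qed

section \<open>Zero products of skew generalized power series\<close>

locale compatible_series = ring R + S: strictly_totally_ordered_monoid S leS
  for R (structure) and S :: "('s, 'm) monoid_scheme" and leS :: "'s rel" +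
  fixes \<omega> :: "'s \<Rightarrow> 'a \<Rightarrow> 'a"
  assumes omega_hom: "\<omega> \<in> monoid_hom S (ring_End R)"
    and compatible: "S_compatible R S \<omega>"
begin

lemma omega_ring_hom: "s \<in> carrier S \<Longrightarrow> \<omega> s \<in> ring_hom R R"
  using omega_hom by (auto simp: monoid_hom_def hom_def ring_End_def)

lemma omega_closed: "s \<in> carrier S \<Longrightarrow> x \<in> carrier R \<Longrightarrow> \<omega> s x \<in> carrier R"
  using omega_ring_hom by (rule ring_hom_closed)

lemma compatible_iff:
  "\<lbrakk> a \<in> carrier R; b \<in> carrier R; s \<in> carrier S \<rbrakk> \<Longrightarrow> a \<otimes> \<omega> s b = \<zero> \<longleftrightarrow> a \<otimes> b = \<zero>"
  using compatible by (auto simp: S_compatible_def)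

text \<open>Compatibility removes \<open>\<omega>\<close> only from the right end of a product, where \<open>b\<close> is in the way.  Since it
  holds in both directions, \<open>b\<close> may first be replaced by \<open>\<omega>\<^sub>s(b)\<close>, which merges with \<open>\<omega>\<^sub>s(y)\<close>.\<close>

lemma untwist:
  assumes s: "s \<in> carrier S" and c: "a \<in> carrier R" "x \<in> carrier R" "y \<in> carrier R" "b \<in> carrier R"
  shows "a \<otimes> (x \<otimes> \<omega> s y) \<otimes> b = \<zero> \<longleftrightarrow> a \<otimes> (x \<otimes> y) \<otimes> b = \<zero>"
proof -
  have "a \<otimes> (x \<otimes> \<omega> s y) \<otimes> b = \<zero> \<longleftrightarrow> a \<otimes> (x \<otimes> \<omega> s y) \<otimes> \<omega> s b = \<zero>"
    using s c omega_closed by (simp add: compatible_iff)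
  also have "a \<otimes> (x \<otimes> \<omega> s y) \<otimes> \<omega> s b = (a \<otimes> x) \<otimes> \<omega> s (y \<otimes> b)"
    using s c omega_closed by (simp add: ring_hom_mult[OF omega_ring_hom] m_assoc)
  also have "\<dots> = \<zero> \<longleftrightarrow> (a \<otimes> x) \<otimes> (y \<otimes> b) = \<zero>"
    using s c by (intro compatible_iff) auto
  finally show ?thesis using c by (simp add: m_assoc)
qed

lemma order_cases:
  assumes "x \<in> carrier S" "y \<in> carrier S"
  shows "x = y \<or> (x, y) \<in> leS \<and> x \<noteq> y \<or> (y, x) \<in> leS \<and> y \<noteq> x"
  using S.linear_order assms unfolding linear_order_on_def total_on_def by blast

lemma order_antisym: "(x, y) \<in> leS \<Longrightarrow> (y, x) \<in> leS \<Longrightarrow> x = y"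
  using S.linear_order unfolding linear_order_on_def partial_order_on_def antisym_def by blast

text \<open>Along the pairs with a fixed product, the second factor is a strictly decreasing function of the
  first.\<close>

lemma equal_products_opposite_order:
  assumes c: "u \<in> carrier S" "v \<in> carrier S" "s \<in> carrier S" "t \<in> carrier S"
    and eq: "u \<otimes>\<^bsub>S\<^esub> v = s \<otimes>\<^bsub>S\<^esub> t"
  shows "(u, s) \<in> leS \<longleftrightarrow> (t, v) \<in> leS" and "u = s \<longleftrightarrow> v = t"
proof -
  have refl: "(x, x) \<in> leS" if "x \<in> carrier S" for x
    using that S.linear_order
    unfolding linear_order_on_def partial_order_on_def preorder_on_def refl_on_def by simp
  have lt: "(t, v) \<in> leS \<and> t \<noteq> v"
    if c: "u \<in> carrier S" "v \<in> carrier S" "s \<in> carrier S" "t \<in> carrier S"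
      and eq: "u \<otimes>\<^bsub>S\<^esub> v = s \<otimes>\<^bsub>S\<^esub> t" and us: "(u, s) \<in> leS" "u \<noteq> s" for u v s t
  proof (rule ccontr)
    assume "\<not> ?thesis"
    then have "v = t \<or> (v, t) \<in> leS \<and> v \<noteq> t" using order_cases[OF c(2,4)] by auto
    then have "(s \<otimes>\<^bsub>S\<^esub> v, s \<otimes>\<^bsub>S\<^esub> t) \<in> leS"
      using S.strict_mult_left[OF c(2,4,3)] refl[OF S.m_closed[OF c(3,4)]] by auto
    moreover have "(u \<otimes>\<^bsub>S\<^esub> v, s \<otimes>\<^bsub>S\<^esub> v) \<in> leS" "u \<otimes>\<^bsub>S\<^esub> v \<noteq> s \<otimes>\<^bsub>S\<^esub> v"
      using S.strict_mult_right[OF c(1,3,2) us] by auto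
    ultimately show False using eq order_antisym[of "s \<otimes>\<^bsub>S\<^esub> v" "s \<otimes>\<^bsub>S\<^esub> t"] by auto
  qed
  have cancel: "v = t" if us: "u = s"
    using order_cases[OF c(2,4)] S.strict_mult_left[OF c(2,4,3)] S.strict_mult_left[OF c(4,2,3)]
      eq us by auto
  have "((u, s) \<in> leS \<longleftrightarrow> (t, v) \<in> leS) \<and> (u = s \<longleftrightarrow> v = t)"
    using order_cases[OF c(1,3)]
  proof (elim disjE conjE)
    assume "u = s" then show ?thesis using cancel refl c by auto
  next
    assume "(u, s) \<in> leS" "u \<noteq> s" then show ?thesis using lt[OF c eq] by auto
  next
    assume su: "(s, u) \<in> leS" "s \<noteq> u"
    then have "(v, t) \<in> leS" "v \<noteq> t" using lt[OF c(3,4,1,2) eq[symmetric]] by auto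
    then show ?thesis using su order_antisym[of u s] order_antisym[of v t] by auto
  qed
  then show "(u, s) \<in> leS \<longleftrightarrow> (t, v) \<in> leS" "u = s \<longleftrightarrow> v = t" by auto
qed

text \<open>The first factors of the decompositions of \<open>s\<close> are well-ordered as part of the support of \<open>f\<close>, and
  conversely well-ordered because the second factors, which determine them and run in the opposite
  direction, are well-ordered as part of the support of \<open>g\<close>.\<close>

lemma finite_X_set:
  assumes f: "artinian_set leS (Supp R S f)" and g: "artinian_set leS (Supp R S g)"
  shows "finite (X_set R S s f g)"
proof -
  let ?X = "X_set R S s f g"
  have X: "u \<in> Supp R S f" "v \<in> Supp R S g" "u \<in> carrier S" "v \<in> carrier S" "u \<otimes>\<^bsub>S\<^esub> v = s"
    if "(u, v) \<in> ?X" for u v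
    using that by (auto simp: X_set_def Supp_def)
  have fst_X: "fst ` ?X \<subseteq> Supp R S f" "fst ` ?X \<subseteq> carrier S"
    by (auto simp: X_set_def Supp_def)
  have "finite (fst ` ?X)"
  proof (rule finite_if_least_and_greatest[OF S.linear_order])
    show "fst ` ?X \<subseteq> carrier S" using fst_X by blast
  next
    fix B assume B: "B \<subseteq> fst ` ?X" "B \<noteq> {}"
    show "\<exists>m\<in>B. \<forall>x\<in>B. (m, x) \<in> leS"
      by (rule artinian_set_least[OF S.linear_order f
            subset_trans[OF B(1) fst_X(1)] subset_trans[OF B(1) fst_X(2)] B(2)])
  next
    fix B assume B: "B \<subseteq> fst ` ?X" "B \<noteq> {}"
    \<comment> \<open>The greatest first factor belongs to the least second factor.\<close>
    let ?V = "{v. \<exists>u\<in>B. (u, v) \<in> ?X}"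
    have V: "?V \<subseteq> Supp R S g" "?V \<subseteq> carrier S" by (auto simp: X_set_def Supp_def)
    have "?V \<noteq> {}"
    proof -
      obtain u where "u \<in> B" using B(2) by blast
      moreover from this obtain p where "p \<in> ?X" "fst p = u" using B(1) by blast
      ultimately show ?thesis by (cases p) auto
    qed
    from artinian_set_least[OF S.linear_order g V this]
    obtain v where "v \<in> ?V" and vmin: "\<forall>v'\<in>?V. (v, v') \<in> leS" ..
    then obtain u where u: "u \<in> B" "(u, v) \<in> ?X" by blast
    have "(u', u) \<in> leS" if u': "u' \<in> B" for u'
    proof -
      obtain v' where v': "(u', v') \<in> ?X" using B(1) u' by auto
      then have "(v, v') \<in> leS" using vmin u' by auto
      then show ?thesis
        using equal_products_opposite_order(1)[of u' v' u v] X[OF v'] X[OF u(2)] by simp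
    qed
    then show "\<exists>m\<in>B. \<forall>x\<in>B. (x, m) \<in> leS" using u(1) by blast
  qed
  moreover have "inj_on fst ?X"
  proof (rule inj_onI)
    fix p q assume p: "p \<in> ?X" and q: "q \<in> ?X" and eq: "fst p = fst q"
    obtain u v where uv: "p = (u, v)" by (cases p)
    with eq obtain v' where uv': "q = (u, v')" by (cases q) auto
    have "v = v'"
      using equal_products_opposite_order(2)[of u v u v'] X[OF p[unfolded uv]] X[OF q[unfolded uv']]
      by simp
    then show "p = q" using uv uv' by simp
  qed
  ultimately show ?thesis by (rule finite_imageD)
qed

text \<open>In the coefficient of \<open>f g\<close> at the product of \<open>s\<close> and \<open>t\<close>, multiplied by \<open>a\<close> and \<open>b\<close>, every term
  other than that of \<open>(s, t)\<close> has a smaller first or second index, so it vanishes after removal of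
  \<open>\<omega>\<close>.\<close>

lemma series_zero_product_leading:
  assumes f: "f \<in> carrier (sgps_ring R S \<omega> leS)" and g: "g \<in> carrier (sgps_ring R S \<omega> leS)"
    and fg: "f \<otimes>\<^bsub>sgps_ring R S \<omega> leS\<^esub> g = \<zero>\<^bsub>sgps_ring R S \<omega> leS\<^esub>"
    and s: "s \<in> carrier S" and t: "t \<in> carrier S" and a: "a \<in> carrier R" and b: "b \<in> carrier R"
    and less_s: "\<And>u v. \<lbrakk> u \<in> carrier S; v \<in> carrier S; (u, s) \<in> leS; u \<noteq> s \<rbrakk>
      \<Longrightarrow> a \<otimes> (f u \<otimes> g v) \<otimes> b = \<zero>"
    and less_t: "\<And>u v. \<lbrakk> u \<in> carrier S; v \<in> carrier S; (v, t) \<in> leS; v \<noteq> t \<rbrakk>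
      \<Longrightarrow> a \<otimes> (f u \<otimes> g v) \<otimes> b = \<zero>"
  shows "a \<otimes> (f s \<otimes> g t) \<otimes> b = \<zero>"
proof -
  have fc: "f u \<in> carrier R" and gc: "g u \<in> carrier R" if "u \<in> carrier S" for u
    using f g that by (auto simp: sgps_ring_def)
  let ?X = "X_set R S (s \<otimes>\<^bsub>S\<^esub> t) f g"
  let ?h = "\<lambda>(u, v). f u \<otimes> \<omega> u (g v)"
  have fin: "finite ?X" using f g by (intro finite_X_set) (auto simp: sgps_ring_def)
  have X: "u \<in> carrier S" "v \<in> carrier S" "u \<otimes>\<^bsub>S\<^esub> v = s \<otimes>\<^bsub>S\<^esub> t" if "(u, v) \<in> ?X" for u v
    using that by (auto simp: X_set_def Supp_def)
  have hc: "?h \<in> ?X \<rightarrow> carrier R"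
    using fc gc omega_closed by (auto simp: X_set_def Supp_def)
  let ?k = "\<lambda>p. a \<otimes> ?h p \<otimes> b"
  have kc: "?k \<in> ?X \<rightarrow> carrier R" using hc a b by (simp add: Pi_iff)
  have other: "a \<otimes> ?h p \<otimes> b = \<zero>" if p: "p \<in> ?X" "p \<noteq> (s, t)" for p
  proof -
    obtain u v where uv: "p = (u, v)" by (cases p)
    note c = X[of u v] p[unfolded uv]
    have "(u, s) \<in> leS \<and> u \<noteq> s \<or> (v, t) \<in> leS \<and> v \<noteq> t"
      using order_cases[of u s] order_cases[of v t] equal_products_opposite_order[of u v s t]
        c s t order_antisym by blast
    then have "a \<otimes> (f u \<otimes> g v) \<otimes> b = \<zero>" using less_s less_t c by blast
    then show ?thesis using untwist[of u a "f u" "g v" b] a b c fc gc uv by simp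
  qed
  show ?thesis
  proof (cases "(s, t) \<in> ?X")
    case False
    then have "f s = \<zero> \<or> g t = \<zero>" using s t by (auto simp: X_set_def Supp_def)
    then show ?thesis using a b fc[OF s] gc[OF t] by auto
  next
    case True
    have "(\<lambda>x\<in>carrier S. finsum R ?h (X_set R S x f g)) = (\<lambda>x\<in>carrier S. \<zero>)"
      using fg by (simp add: sgps_ring_def)
    from fun_cong[OF this, of "s \<otimes>\<^bsub>S\<^esub> t"] have "finsum R ?h ?X = \<zero>" using s t by simp
    then have "\<zero> = a \<otimes> finsum R ?h ?X \<otimes> b" using a b by simp
    also have "\<dots> = finsum R ?k ?X"
      using fin a b hc by (simp add: finsum_ldistr finsum_rdistr Pi_iff)
    also have "\<dots> = finsum R (\<lambda>p. if (s, t) = p then ?k p else \<zero>) ?X"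
    proof (rule finsum_cong'[OF refl])
      show "(\<lambda>p. if (s, t) = p then ?k p else \<zero>) \<in> ?X \<rightarrow> carrier R"
        using kc by (simp add: Pi_iff)
      show "?k p = (if (s, t) = p then ?k p else \<zero>)" if "p \<in> ?X" for p
        using other[OF that] by (cases "(s, t) = p") auto
    qed
    also have "\<dots> = ?k (s, t)"
      using True fin kc by (rule finsum_singleton)
    finally show ?thesis using untwist[of s a "f s" "g t" b] s t a b fc gc by simp
  qed
qed

lemma mult_const_series_zero:
  assumes f: "f \<in> carrier S \<rightarrow> carrier R" and c: "c \<in> carrier R"
    and zero: "\<And>s. s \<in> carrier S \<Longrightarrow> f s \<otimes> c = \<zero>"
  shows "f \<otimes>\<^bsub>sgps_ring R S \<omega> leS\<^esub> const_series R S c = \<zero>\<^bsub>sgps_ring R S \<omega> leS\<^esub>"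
proof -
  have "f u \<otimes> \<omega> u (const_series R S c v) = \<zero>" if "u \<in> carrier S" "v \<in> carrier S" for u v
  proof -
    have "f u \<in> carrier R" using that(1) f by auto
    then show ?thesis using that c zero by (simp add: const_series_def compatible_iff)
  qed
  then show ?thesis
    unfolding sgps_ring_def
    by (auto simp: X_set_def Supp_def intro!: restrict_ext add.finprod_one_eqI)
qed

lemma const_series_mult_zero:
  assumes g: "g \<in> carrier S \<rightarrow> carrier R" and c: "c \<in> carrier R"
    and zero: "\<And>s. s \<in> carrier S \<Longrightarrow> c \<otimes> g s = \<zero>"
  shows "const_series R S c \<otimes>\<^bsub>sgps_ring R S \<omega> leS\<^esub> g = \<zero>\<^bsub>sgps_ring R S \<omega> leS\<^esub>"
proof -
  have "const_series R S c u \<otimes> \<omega> u (g v) = \<zero>" if "u \<in> carrier S" "v \<in> carrier S" for u v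
  proof -
    have "g v \<in> carrier R" using that(2) g by auto
    then show ?thesis using that c zero by (simp add: const_series_def compatible_iff omega_closed)
  qed
  then show ?thesis
    unfolding sgps_ring_def
    by (auto simp: X_set_def Supp_def intro!: restrict_ext add.finprod_one_eqI)
qed

end

theorem theorem2p9:
  fixes R :: "('r, 'n) ring_scheme"
    and S :: "('s, 'm) monoid_scheme"
    and leS :: "'s rel"
    and \<omega> :: "'s \<Rightarrow> 'r \<Rightarrow> 'r"
  assumes "ring R"
    and "strictly_totally_ordered_monoid S leS"
    and "\<omega> \<in> monoid_hom S (ring_End R)"
    and "S_compatible R S \<omega>"
    and "abelian_idempotents R"
    and "semi_regular R"
    and "nilpotent_ideal (jacobson_radical R) R"
  shows "McCoy R S \<omega> leS"
proof -
  interpret compatible_series R S leS \<omega>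
    using assms(1-4) by (intro compatible_series.intro compatible_series_axioms.intro)
  let ?A = "sgps_ring R S \<omega> leS"
  let ?J = "jacobson_radical R"
  let ?P = "\<lambda>k::nat. ?J [^]\<^bsub>ideals_set R\<^esub> k"
  note J = jacobson_radical_ideal
  interpret J: ideal ?J R by (rule J)
  obtain n where nil: "?P n = {\<zero>\<^bsub>R\<^esub>}" using assms(7) unfolding nilpotent_ideal_def by blast
  have unit_part: "\<exists>e. unit_part R ?J a e" if "a \<in> carrier R" for a
    using unit_part_exists[OF J nil assms(5) _ _ that] assms(6) by (simp add: semi_regular_def)
  have P_0: "?P 0 = carrier R" by (simp add: ideals_set_def)
  have P_ideal: "ideal (?P k) R" for k by (rule ideal_pow_ideal[OF J])
  have Jc: "?J \<subseteq> carrier R" using J.Icarr by blast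
  have Pc: "?P k \<subseteq> carrier R" for k using ideal.Icarr[OF P_ideal] by blast
  have P_r: "a \<otimes>\<^bsub>R\<^esub> x \<in> ?P k" and P_l: "x \<otimes>\<^bsub>R\<^esub> a \<in> ?P k"
    if "a \<in> ?P k" "x \<in> carrier R" for a x k
    using that ideal.I_r_closed[OF P_ideal] ideal.I_l_closed[OF P_ideal] by auto
  have JP: "d \<otimes>\<^bsub>R\<^esub> a \<in> ?P (Suc k)" if "d \<in> ?J" "a \<in> ?P k" for d a k
    using ideal_pow_mult_left[OF J that] .
  have PJ: "a \<otimes>\<^bsub>R\<^esub> d \<in> ?P (Suc k)" if "a \<in> ?P k" "d \<in> ?J" for d a k
    unfolding ideal_pow_Suc using that by (rule ideal_prod.prod)
  have annihilators:
    "(\<exists>c\<in>carrier R. c \<noteq> \<zero>\<^bsub>R\<^esub> \<and> f \<otimes>\<^bsub>?A\<^esub> const_series R S c = \<zero>\<^bsub>?A\<^esub>) \<and>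
     (\<exists>c\<in>carrier R. c \<noteq> \<zero>\<^bsub>R\<^esub> \<and> const_series R S c \<otimes>\<^bsub>?A\<^esub> g = \<zero>\<^bsub>?A\<^esub>)"
    if f: "f \<in> carrier ?A" "f \<noteq> \<zero>\<^bsub>?A\<^esub>" and g: "g \<in> carrier ?A" "g \<noteq> \<zero>\<^bsub>?A\<^esub>"
      and fg: "f \<otimes>\<^bsub>?A\<^esub> g = \<zero>\<^bsub>?A\<^esub>" for f g
  proof -
    have nonzero: "\<exists>s\<in>carrier S. h s \<noteq> \<zero>\<^bsub>R\<^esub>" if "h \<in> carrier ?A" "h \<noteq> \<zero>\<^bsub>?A\<^esub>" for h
      using that
      by (auto simp: sgps_ring_def fun_eq_iff PiE_def extensional_def split: if_splits)
    have fc: "f \<in> carrier S \<rightarrow> carrier R" and gc: "g \<in> carrier S \<rightarrow> carrier R"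
      and fa: "artinian_set leS {s \<in> carrier S. f s \<noteq> \<zero>\<^bsub>R\<^esub>}"
      and ga: "artinian_set leS {s \<in> carrier S. g s \<noteq> \<zero>\<^bsub>R\<^esub>}"
      using f(1) g(1) by (auto simp: sgps_ring_def Supp_def)
    have fR: "f s \<in> carrier R" and gR: "g s \<in> carrier R" if "s \<in> carrier S" for s
      using fc gc that by auto
    note leading = series_zero_product_leading[OF f(1) g(1) fg]
    have right: "well_ordered_zero_product R (carrier S) leS f g ?J ?P n"
    proof (intro well_ordered_zero_product.intro well_ordered_zero_product_axioms.intro)
      show "artinian_set leS {s \<in> carrier S. f s \<noteq> \<zero>\<^bsub>R\<^esub>}" by (rule fa)
      show "artinian_set leS {s \<in> carrier S. g s \<noteq> \<zero>\<^bsub>R\<^esub>}" by (rule ga)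
      show "\<exists>e. unit_part R ?J (f s) e" if "s \<in> carrier S" for s
        by (rule unit_part[OF fR[OF that]])
    qed (fact assms(1) S.linear_order fR gR leading Jc P_0 nil Pc P_r PJ JP)+
    \<comment> \<open>The same argument with the order of multiplication and the two series exchanged.\<close>
    have left: "well_ordered_zero_product (opposite R) (carrier S) leS g f ?J ?P n"
    proof (intro well_ordered_zero_product.intro well_ordered_zero_product_axioms.intro,
        unfold opposite_simps)
      show "artinian_set leS {s \<in> carrier S. g s \<noteq> \<zero>\<^bsub>R\<^esub>}" by (rule ga)
      show "artinian_set leS {s \<in> carrier S. f s \<noteq> \<zero>\<^bsub>R\<^esub>}" by (rule fa)
      show "\<exists>e. unit_part (opposite R) ?J (g s) e" if "s \<in> carrier S" for s
        using unit_part[OF gR[OF that]] unit_part_opposite[OF _ gR[OF that]] by blast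
    next
      fix s t a b
      assume c: "s \<in> carrier S" "t \<in> carrier S" "a \<in> carrier R" "b \<in> carrier R"
        and less_s: "\<And>u v. \<lbrakk> u \<in> carrier S; v \<in> carrier S; (u, s) \<in> leS; u \<noteq> s \<rbrakk> \<Longrightarrow>
          b \<otimes>\<^bsub>R\<^esub> (f v \<otimes>\<^bsub>R\<^esub> g u \<otimes>\<^bsub>R\<^esub> a) = \<zero>\<^bsub>R\<^esub>"
        and less_t: "\<And>u v. \<lbrakk> u \<in> carrier S; v \<in> carrier S; (v, t) \<in> leS; v \<noteq> t \<rbrakk> \<Longrightarrow>
          b \<otimes>\<^bsub>R\<^esub> (f v \<otimes>\<^bsub>R\<^esub> g u \<otimes>\<^bsub>R\<^esub> a) = \<zero>\<^bsub>R\<^esub>"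
      have assoc: "b \<otimes>\<^bsub>R\<^esub> (f v \<otimes>\<^bsub>R\<^esub> g u) \<otimes>\<^bsub>R\<^esub> a = b \<otimes>\<^bsub>R\<^esub> (f v \<otimes>\<^bsub>R\<^esub> g u \<otimes>\<^bsub>R\<^esub> a)"
        if "u \<in> carrier S" "v \<in> carrier S" for u v
        using c(3,4) fR[OF that(2)] gR[OF that(1)] by (simp add: m_assoc)
      have "b \<otimes>\<^bsub>R\<^esub> (f t \<otimes>\<^bsub>R\<^esub> g s) \<otimes>\<^bsub>R\<^esub> a = \<zero>\<^bsub>R\<^esub>"
        by (rule leading[OF c(2,1,4,3)]) (simp_all add: assoc less_s less_t)
      then show "b \<otimes>\<^bsub>R\<^esub> (f t \<otimes>\<^bsub>R\<^esub> g s \<otimes>\<^bsub>R\<^esub> a) = \<zero>\<^bsub>R\<^esub>"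
        by (simp only: assoc[OF c(1,2)])
    qed (fact ring_opposite S.linear_order fR gR Jc P_0 nil Pc P_l | rule JP PJ, assumption, assumption)+
    show ?thesis
    proof
      obtain t where "t \<in> carrier S" "g t \<noteq> \<zero>\<^bsub>R\<^esub>" using nonzero[OF g] by blast
      from well_ordered_zero_product.exists_common_annihilator[OF right this]
      show "\<exists>c\<in>carrier R. c \<noteq> \<zero>\<^bsub>R\<^esub> \<and> f \<otimes>\<^bsub>?A\<^esub> const_series R S c = \<zero>\<^bsub>?A\<^esub>"
        using mult_const_series_zero[OF fc] by blast
      obtain s where "s \<in> carrier S" "f s \<noteq> \<zero>\<^bsub>opposite R\<^esub>" using nonzero[OF f] by auto
      from well_ordered_zero_product.exists_common_annihilator[OF left this]
      show "\<exists>c\<in>carrier R. c \<noteq> \<zero>\<^bsub>R\<^esub> \<and> const_series R S c \<otimes>\<^bsub>?A\<^esub> g = \<zero>\<^bsub>?A\<^esub>"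
        unfolding opposite_simps using const_series_mult_zero[OF gc] by blast
    qed
  qed
  then show ?thesis unfolding McCoy_def left_McCoy_def right_McCoy_def Let_def by blast
qed

end
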